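(* Let the mesh $\mathcal T_h$ be weakly acute. Then, for all $(s_h,\mathbf\Theta_h,\mathbf U_h)\in\mathcal A^h_{\mathrm{uni}}(g_h,\mathbf R_h)$, the main part of the discrete Landau–de Gennes energy satisfies $$E^h_{\mathrm{uni-m}}[s_h,\mathbf\Theta_h]-\widetilde E^h_{\mathrm{uni-m}}[s_h,\mathbf U_h]=\mathcal E_h$$ as well as $$E^h_{\mathrm{uni-m}}[s_h,\mathbf\Theta_h]-\widetilde E^h_{\mathrm{uni-m}}[\widetilde s_h,\widetilde{\mathbf U}_h]\ge\widetilde{\mathcal E}_h,$$ where $\widetilde s_h=I_h(|s_h|)$, $\widetilde{\mathbf U}_h=I_h(|s_h|\mathbf\Theta_h)$, and $$\mathcal E_h:=\frac18\sum_{i,j=1}^Nk_{ij}(\delta_{ij}s_h)^2|\delta_{ij}\mathbf\Theta_h|^2\ge0,\qquad \widetilde{\mathcal E}_h:=\frac18\sum_{i,j=1}^Nk_{ij}(\delta_{ij}\widetilde s_h)^2|\delta_{ij}\mathbf\Theta_h|^2\ge0 .$$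
   Context: $d\ge2$, $\Omega\subset\mathbb R^d$ is a bounded polyhedral domain. $\mathcal T_h$ is a conforming, shape-regular, quasi-uniform simplicial triangulation of $\Omega$ with nodes $x_1,\dots,x_N$, hat functions $\phi_i$ and Lagrange interpolation operator $I_h$; $k_{ij}:=-\int_\Omega\nabla\phi_i\cdot\nabla\phi_j\,dx$. Weakly acute means $k_{ij}\ge0$ for all $i\ne j$. $\mathbb L^{d-1}=\{\mathbf n\otimes\mathbf n:\mathbf n\in\mathbb R^d,\ |\mathbf n|=1\}$. $\mathbb S_h$ is the space of continuous piecewise affine functions on $\mathcal T_h$, $\mathbb U_h=[\mathbb S_h]^{d\times d}$, $\mathbb T_h=\{\mathbf\Theta_h\in\mathbb U_h:\mathbf\Theta_h(x_i)\in\mathbb L^{d-1}\ \forall i\}$. Matrices carry the Frobenius norm, and $\delta_{ij}v:=v(x_i)-v(x_j)$. $\Gamma_s$ and $\Gamma_{\mathbf\Theta}=\Gamma_{\mathbf U}$ are relatively open subsets of $\partial\Omega$. The data $(g,\mathbf M,\mathbf R)\in W^1_\infty(\mathbb R^d)\times[L^\infty(\mathbb R^d)]^{d\times d}\times[W^1_\infty(\mathbb R^d)]^{d\times d}$ satisfy $-\frac1{d-1}\le g\le1$, $\mathbf R=g\mathbf M$, $\mathbf M\in\mathbb L^{d-1}$ in a neighborhood of $\partial\Omega$, and for some $\delta_0>0$: $-\frac1{d-1}+\delta_0\le g\le1-\delta_0$ in $\Omega$, $g\ge\delta_0$ on $\partial\Omega$. With $g_h=I_hg$, $\mathbf R_h=I_h\mathbf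 R$, $\mathbf M_h=I_h\mathbf M$, the set $\mathcal A^h_{\mathrm{uni}}(g_h,\mathbf R_h)$ consists of all $(s_h,\mathbf\Theta_h,\mathbf U_h)\in\mathbb S_h\times\mathbb T_h\times\mathbb U_h$ with $s_h=g_h$ on $\Gamma_s$, $\mathbf\Theta_h=\mathbf M_h$ on $\Gamma_{\mathbf\Theta}$, $\mathbf U_h=\mathbf R_h$ on $\Gamma_{\mathbf U}$, $\mathbf U_h=I_h(s_h\mathbf\Theta_h)$ and $-\frac1{d-1}\le s_h\le1$. The energies are $$E^h_{\mathrm{uni-m}}[s_h,\mathbf\Theta_h]=\frac{d-1}{4d}\sum_{i,j=1}^Nk_{ij}(\delta_{ij}s_h)^2+\frac14\sum_{i,j=1}^Nk_{ij}\frac{s_h(x_i)^2+s_h(x_j)^2}2|\delta_{ij}\mathbf\Theta_h|^2,$$ $$\widetilde E^h_{\mathrm{uni-m}}[s_h,\mathbf U_h]=-\frac1{2d}\int_\Omega|\nabla s_h|^2dx+\frac12\int_\Omega|\nabla\mathbf U_h|^2dx .$$ *)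

theory Defs
  imports "HOL-Analysis.Analysis"
begin

section \<open>Derivatives and function spaces\<close>

text \<open>
  Classical partial derivative.  Functions of the finite element spaces below are affine on each
  simplex, so on a mesh of \<open>closure \<Omega>\<close> their classical partial derivatives exist almost everywhere
  and coincide there with the weak ones.
\<close>

definition partial_deriv ::
    "'n::finite \<Rightarrow> (real^'n \<Rightarrow> 'b::real_normed_vector) \<Rightarrow> real^'n \<Rightarrow> 'b" where
  "partial_deriv k f x = frechet_derivative f (at x) (axis k 1)"

text \<open>
  \<open>dirichlet \<Omega> u v\<close> is the integral of \<open>\<nabla>u \<cdot> \<nabla>v\<close>.  On \<open>real^'n^'n\<close> the library's \<open>\<bullet>\<close> and \<open>norm\<close> are the
  Frobenius inner product and norm.
\<close>

definition dirichlet ::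
    "(real^'n::finite) set \<Rightarrow> (real^'n \<Rightarrow> 'b::euclidean_space) \<Rightarrow> (real^'n \<Rightarrow> 'b) \<Rightarrow> real" where
  "dirichlet \<Omega> u v =
     (LINT x:\<Omega>|lebesgue. (\<Sum>k\<in>UNIV. partial_deriv k u x \<bullet> partial_deriv k v x))"

definition smooth_fun :: "(real^'n::finite \<Rightarrow> real) \<Rightarrow> bool" where
  "smooth_fun \<psi> \<longleftrightarrow> (\<forall>ks. foldr partial_deriv ks \<psi> differentiable_on UNIV)"

definition test_fun :: "(real^'n::finite \<Rightarrow> real) \<Rightarrow> bool" where
  "test_fun \<psi> \<longleftrightarrow> smooth_fun \<psi> \<and> (\<exists>K. compact K \<and> (\<forall>x. x \<notin> K \<longrightarrow> \<psi> x = 0))"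

definition L_infty :: "(real^'n::finite \<Rightarrow> real) set" where
  "L_infty = {f. f \<in> borel_measurable lebesgue \<and> (\<exists>C. AE x in lebesgue. \<bar>f x\<bar> \<le> C)}"

definition weak_partial ::
    "'n::finite \<Rightarrow> (real^'n \<Rightarrow> real) \<Rightarrow> (real^'n \<Rightarrow> real) \<Rightarrow> bool" where
  "weak_partial k u v \<longleftrightarrow>
     (\<forall>\<psi>. test_fun \<psi> \<longrightarrow>
        (LINT x|lebesgue. u x * partial_deriv k \<psi> x) = - (LINT x|lebesgue. v x * \<psi> x))"

text \<open>
  Elements of \<open>W\<^sup>1\<^sub>\<infinity>\<close> are represented by their continuous representative, so that point values
  (needed for Lagrange interpolation) make sense.
\<close>

definition W1_infty :: "(real^'n::finite \<Rightarrow> real) set" where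
  "W1_infty = {u \<in> L_infty. continuous_on UNIV u \<and> (\<forall>k. \<exists>v\<in>L_infty. weak_partial k u v)}"

definition matrix_valued ::
    "(real^'n::finite \<Rightarrow> real) set \<Rightarrow> (real^'n \<Rightarrow> real^'n^'n) set" where
  "matrix_valued X = {V. \<forall>i j. (\<lambda>x. V x $ i $ j) \<in> X}"


section \<open>Domains and meshes\<close>

definition bounded_polyhedral_domain :: "(real^'n::finite) set \<Rightarrow> bool" where
  "bounded_polyhedral_domain \<Omega> \<longleftrightarrow>
     open \<Omega> \<and> connected \<Omega> \<and> \<Omega> \<noteq> {} \<and> bounded \<Omega> \<and>
     (\<exists>F. finite F \<and> (\<forall>P\<in>F. polytope P \<and> aff_dim P = int CARD('n) - 1) \<and> frontier \<Omega> = \<Union>F)"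

text \<open>
  The library's \<open>triangulation\<close> is a finite set of simplices any two of which meet in a common
  (possibly empty) face, i.e. conformity.
\<close>

definition conforming_mesh :: "(real^'n::finite) set \<Rightarrow> (real^'n) set set \<Rightarrow> bool" where
  "conforming_mesh \<Omega> \<T> \<longleftrightarrow>
     triangulation \<T> \<and> (\<forall>T\<in>\<T>. int CARD('n) simplex T) \<and> \<Union>\<T> = closure \<Omega>"

definition mesh_size :: "(real^'n::finite) set set \<Rightarrow> real" where
  "mesh_size \<T> = Max (diameter ` \<T>)"

text \<open>
  Shape regularity and quasi-uniformity are properties of a family of meshes: the constant does
  not depend on the member.
\<close>

definition shape_regular :: "(real^'n::finite) set set set \<Rightarrow> bool" where
  "shape_regular \<F> \<longleftrightarrow> (\<exists>\<sigma>>0. \<forall>\<T>\<in>\<F>. \<forall>T\<in>\<T>. \<exists>x. cball x (\<sigma> * diameter T) \<subseteq> T)"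

definition quasi_uniform :: "(real^'n::finite) set set set \<Rightarrow> bool" where
  "quasi_uniform \<F> \<longleftrightarrow> (\<exists>c>0. \<forall>\<T>\<in>\<F>. \<forall>T\<in>\<T>. c * mesh_size \<T> \<le> diameter T)"

definition nodes :: "(real^'n::finite) set set \<Rightarrow> (real^'n) set" where
  "nodes \<T> = {x. \<exists>T\<in>\<T>. x extreme_point_of T}"


section \<open>Finite element spaces\<close>

text \<open>
  Functions are total in HOL; membership in the spaces below only constrains values on
  \<open>\<Union>\<T> = closure \<Omega>\<close>, so equality of their elements means equality on that set.
\<close>

definition S_space :: "(real^'n::finite) set set \<Rightarrow> (real^'n \<Rightarrow> real) set" where
  "S_space \<T> = {v. continuous_on (\<Union>\<T>) v \<and> (\<forall>T\<in>\<T>. \<exists>a b. \<forall>x\<in>T. v x = a \<bullet> x + b)}"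

definition U_space :: "(real^'n::finite) set set \<Rightarrow> (real^'n \<Rightarrow> real^'n^'n) set" where
  "U_space \<T> = matrix_valued (S_space \<T>)"

definition outer_product :: "real^'n::finite \<Rightarrow> real^'n \<Rightarrow> real^'n^'n" where
  "outer_product m n = (\<chi> i j. m $ i * n $ j)"

definition line_field_space :: "(real^'n::finite^'n) set" where
  "line_field_space = {outer_product n n | n. norm n = 1}"

definition T_space :: "(real^'n::finite) set set \<Rightarrow> (real^'n \<Rightarrow> real^'n^'n) set" where
  "T_space \<T> = {\<Theta> \<in> U_space \<T>. \<forall>z\<in>nodes \<T>. \<Theta> z \<in> line_field_space}"

text \<open>Setting the hat function to 0 off the mesh makes the definite description unique.\<close>

definition hat :: "(real^'n::finite) set set \<Rightarrow> real^'n \<Rightarrow> real^'n \<Rightarrow> real" where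
  "hat \<T> z = (THE \<phi>. \<phi> \<in> S_space \<T> \<and> (\<forall>w\<in>nodes \<T>. \<phi> w = (if w = z then 1 else 0)) \<and>
                      (\<forall>x. x \<notin> \<Union>\<T> \<longrightarrow> \<phi> x = 0))"

definition interp ::
    "(real^'n::finite) set set \<Rightarrow> (real^'n \<Rightarrow> 'b::real_vector) \<Rightarrow> real^'n \<Rightarrow> 'b" where
  "interp \<T> v x = (\<Sum>z\<in>nodes \<T>. hat \<T> z x *\<^sub>R v z)"

definition stiffness ::
    "(real^'n::finite) set \<Rightarrow> (real^'n) set set \<Rightarrow> real^'n \<Rightarrow> real^'n \<Rightarrow> real" where
  "stiffness \<Omega> \<T> z w = - dirichlet \<Omega> (hat \<T> z) (hat \<T> w)"

definition weakly_acute :: "(real^'n::finite) set \<Rightarrow> (real^'n) set set \<Rightarrow> bool" where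
  "weakly_acute \<Omega> \<T> \<longleftrightarrow> (\<forall>z\<in>nodes \<T>. \<forall>w\<in>nodes \<T>. z \<noteq> w \<longrightarrow> stiffness \<Omega> \<T> z w \<ge> 0)"


section \<open>Boundary data, admissible class and energies\<close>

text \<open>
  \<open>M\<close> is only essentially bounded, but \<open>interp\<close> needs its point values; hence a fixed representative
  is used, for which \<open>R = g M\<close> and the condition near the boundary hold pointwise.
\<close>

definition admissible_data ::
    "(real^'n::finite) set \<Rightarrow> (real^'n \<Rightarrow> real) \<Rightarrow> (real^'n \<Rightarrow> real^'n^'n) \<Rightarrow>
     (real^'n \<Rightarrow> real^'n^'n) \<Rightarrow> bool" where
  "admissible_data \<Omega> g M R \<longleftrightarrow>
     g \<in> W1_infty \<and> M \<in> matrix_valued L_infty \<and> R \<in> matrix_valued W1_infty \<and>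
     (\<forall>x. - 1 / (real CARD('n) - 1) \<le> g x \<and> g x \<le> 1) \<and>
     (\<forall>x. R x = g x *\<^sub>R M x) \<and>
     (\<exists>V. open V \<and> frontier \<Omega> \<subseteq> V \<and> (\<forall>x\<in>V. M x \<in> line_field_space)) \<and>
     (\<exists>\<delta>\<^sub>0>0. (\<forall>x\<in>\<Omega>. - 1 / (real CARD('n) - 1) + \<delta>\<^sub>0 \<le> g x \<and> g x \<le> 1 - \<delta>\<^sub>0) \<and>
             (\<forall>x\<in>frontier \<Omega>. \<delta>\<^sub>0 \<le> g x))"

text \<open>\<open>\<Gamma>\<^sub>\<Theta>\<close> also serves as the Dirichlet boundary of \<open>U\<close>.\<close>

definition A_uni ::
    "(real^'n::finite) set set \<Rightarrow> (real^'n) set \<Rightarrow> (real^'n) set \<Rightarrow>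
     (real^'n \<Rightarrow> real) \<Rightarrow> (real^'n \<Rightarrow> real^'n^'n) \<Rightarrow> (real^'n \<Rightarrow> real^'n^'n) \<Rightarrow>
     ((real^'n \<Rightarrow> real) \<times> (real^'n \<Rightarrow> real^'n^'n) \<times> (real^'n \<Rightarrow> real^'n^'n)) set" where
  "A_uni \<T> \<Gamma>\<^sub>s \<Gamma>\<^sub>\<Theta> g\<^sub>h M\<^sub>h R\<^sub>h =
     {(s, \<Theta>, U). s \<in> S_space \<T> \<and> \<Theta> \<in> T_space \<T> \<and> U \<in> U_space \<T> \<and>
        (\<forall>x\<in>\<Gamma>\<^sub>s. s x = g\<^sub>h x) \<and> (\<forall>x\<in>\<Gamma>\<^sub>\<Theta>. \<Theta> x = M\<^sub>h x) \<and> (\<forall>x\<in>\<Gamma>\<^sub>\<Theta>. U x = R\<^sub>h x) \<and>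
        (\<forall>x\<in>\<Union>\<T>. U x = interp \<T> (\<lambda>y. s y *\<^sub>R \<Theta> y) x) \<and>
        (\<forall>x\<in>\<Union>\<T>. - 1 / (real CARD('n) - 1) \<le> s x \<and> s x \<le> 1)}"

definition E_uni_m ::
    "(real^'n::finite) set \<Rightarrow> (real^'n) set set \<Rightarrow> (real^'n \<Rightarrow> real) \<Rightarrow>
     (real^'n \<Rightarrow> real^'n^'n) \<Rightarrow> real" where
  "E_uni_m \<Omega> \<T> s \<Theta> =
     (real CARD('n) - 1) / (4 * real CARD('n)) *
       (\<Sum>z\<in>nodes \<T>. \<Sum>w\<in>nodes \<T>. stiffness \<Omega> \<T> z w * (s z - s w)\<^sup>2) +
     1 / 4 * (\<Sum>z\<in>nodes \<T>. \<Sum>w\<in>nodes \<T>.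
       stiffness \<Omega> \<T> z w * (((s z)\<^sup>2 + (s w)\<^sup>2) / 2) * (norm (\<Theta> z - \<Theta> w))\<^sup>2)"

definition E_tilde_uni_m ::
    "(real^'n::finite) set \<Rightarrow> (real^'n \<Rightarrow> real) \<Rightarrow> (real^'n \<Rightarrow> real^'n^'n) \<Rightarrow> real" where
  "E_tilde_uni_m \<Omega> s U =
     - (1 / (2 * real CARD('n))) * dirichlet \<Omega> s s + 1 / 2 * dirichlet \<Omega> U U"

definition residual ::
    "(real^'n::finite) set \<Rightarrow> (real^'n) set set \<Rightarrow> (real^'n \<Rightarrow> real) \<Rightarrow>
     (real^'n \<Rightarrow> real^'n^'n) \<Rightarrow> real" where
  "residual \<Omega> \<T> s \<Theta> =
     1 / 8 * (\<Sum>z\<in>nodes \<T>. \<Sum>w\<in>nodes \<T>.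
       stiffness \<Omega> \<T> z w * (s z - s w)\<^sup>2 * (norm (\<Theta> z - \<Theta> w))\<^sup>2)"

end

theory Submission
  imports Defs
begin

text \<open>
  Both energies are sums over pairs of nodes weighted by the stiffness entries \<open>k\<^sub>z\<^sub>w\<close>, so they can be
  compared pair by pair.

  On the continuous side, a finite element function with nodal values \<open>a\<close> has Dirichlet energy
  \<open>1/2 \<Sum> k\<^sub>z\<^sub>w \<bar>a z - a w\<bar>\<^sup>2\<close> (\<open>dirichlet_energy_differences\<close>).  Bilinearity in the hat functions gives
  \<open>- \<Sum> k\<^sub>z\<^sub>w a z \<bullet> a w\<close> (\<open>dirichlet_interp\<close>), and the squares \<open>\<bar>a z\<bar>\<^sup>2\<close> can be added for free because the
  hat functions sum to 1 and the gradient of a constant vanishes (\<open>stiffness_row_sum\<close>).  Applied to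
  \<open>s\<close> and to \<open>U\<close>, whose nodal values are \<open>s \<Theta>\<close>, this puts all terms in the form
  \<open>\<Sum> k\<^sub>z\<^sub>w (\<dots>)\<close>.

  Line fields have Frobenius norm 1, so
  \<open>\<bar>s z \<Theta> z - s w \<Theta> w\<bar>\<^sup>2 = (s z - s w)\<^sup>2 + s z s w \<bar>\<Theta> z - \<Theta> w\<bar>\<^sup>2\<close> (\<open>norm_diff_scaled_unit\<close>).  The discrete
  energy carries the arithmetic mean of \<open>(s z)\<^sup>2\<close> and \<open>(s w)\<^sup>2\<close> instead of the product \<open>s z s w\<close>; these differ
  by \<open>(s z - s w)\<^sup>2 / 2\<close>, which produces the residual (\<open>energy_identity\<close>).  The identity holds for any nodal
  values, in particular for \<open>\<bar>s\<bar>\<close>, and replacing \<open>s\<close> by \<open>\<bar>s\<bar>\<close> does not increase the discrete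
  energy on a weakly acute mesh (\<open>energy_abs_le\<close>), which gives the inequality.

  Hat functions are introduced by definite description, so the bilinear expansion also rests on
  their existence and uniqueness on a conforming mesh (\<open>nodal_interpolant_exists\<close>,
  \<open>nodal_values_determine\<close>).
\<close>

section \<open>Affine functions on simplices\<close>

definition affine_fun_on :: "'a::real_inner set \<Rightarrow> ('a \<Rightarrow> real) \<Rightarrow> bool" where
  "affine_fun_on T f \<longleftrightarrow> (\<exists>a b. \<forall>x\<in>T. f x = a \<bullet> x + b)"

lemma affine_fun_on_sum:
  assumes "\<And>i. i \<in> I \<Longrightarrow> affine_fun_on T (f i)"
  shows "affine_fun_on T (\<lambda>x. \<Sum>i\<in>I. f i x * c i)"
proof -
  obtain a b where ab: "\<And>i x. i \<in> I \<Longrightarrow> x \<in> T \<Longrightarrow> f i x = a i \<bullet> x + b i"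
    using assms unfolding affine_fun_on_def by metis
  have "(\<Sum>i\<in>I. f i x * c i) = (\<Sum>i\<in>I. c i *\<^sub>R a i) \<bullet> x + (\<Sum>i\<in>I. c i * b i)" if "x \<in> T" for x
    using that by (simp add: ab inner_sum_left algebra_simps sum.distrib)
  then show ?thesis unfolding affine_fun_on_def by blast
qed

text \<open>
  Two affine functions agree on a convex set (a hyperplane, everything, or nothing), and a compact
  convex set is the convex hull of its extreme points.
\<close>

lemma affine_fun_on_eqI:
  fixes T :: "'a::euclidean_space set"
  assumes "compact T" "convex T" "affine_fun_on T f" "affine_fun_on T g"
    and eq: "\<And>z. z extreme_point_of T \<Longrightarrow> f z = g z" and "x \<in> T"
  shows "f x = g x"
proof -
  obtain a b where f: "\<And>x. x \<in> T \<Longrightarrow> f x = a \<bullet> x + b"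
    using assms(3) unfolding affine_fun_on_def by blast
  obtain a' b' where g: "\<And>x. x \<in> T \<Longrightarrow> g x = a' \<bullet> x + b'"
    using assms(4) unfolding affine_fun_on_def by blast
  have "{z. z extreme_point_of T} \<subseteq> {x. (a - a') \<bullet> x = b' - b}"
  proof
    fix z assume z: "z \<in> {z. z extreme_point_of T}"
    then have "z \<in> T" by (simp add: extreme_point_of_def)
    then show "z \<in> {x. (a - a') \<bullet> x = b' - b}"
      using z eq[of z] f[of z] g[of z] by (simp add: inner_diff_left)
  qed
  then have "convex hull {z. z extreme_point_of T} \<subseteq> {x. (a - a') \<bullet> x = b' - b}"
    by (rule hull_minimal) (rule convex_hyperplane)
  then have "x \<in> {x. (a - a') \<bullet> x = b' - b}"
    using Krein_Milman_Minkowski[OF assms(1,2)] \<open>x \<in> T\<close> by blast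
  then show ?thesis
    using f[OF \<open>x \<in> T\<close>] g[OF \<open>x \<in> T\<close>] by (simp add: inner_diff_left)
qed

text \<open>
  Affine independence of the vertices means linear independence of the edges leaving one of them,
  so a linear functional can be prescribed on these edges.
\<close>

lemma affine_interpolation_exists:
  fixes C :: "'a::euclidean_space set"
  assumes "\<not> affine_dependent C"
  shows "\<exists>a b. \<forall>z\<in>C. val z = a \<bullet> z + b"
proof (cases "C = {}")
  case False
  then obtain p where p: "p \<in> C" by blast
  then have "independent ((\<lambda>x. - p + x) ` (C - {p}))"
    using assms affine_dependent_iff_dependent2 by blast
  then obtain f :: "'a \<Rightarrow> real" where f: "linear f"
      "\<And>y. y \<in> (\<lambda>x. - p + x) ` (C - {p}) \<Longrightarrow> f y = val (p + y) - val p"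
    using linear_independent_extend[of _ "\<lambda>y. val (p + y) - val p"] by blast
  define a where "a = adjoint f 1"
  have a: "f y = a \<bullet> y" for y
    using adjoint_works[OF f(1), of y 1] by (simp add: a_def inner_commute)
  have "val z = a \<bullet> z + (val p - a \<bullet> p)" if "z \<in> C" for z
  proof (cases "z = p")
    case False
    then have "f (- p + z) = val z - val p"
      using f(2)[of "- p + z"] that by auto
    then show ?thesis by (simp add: a inner_diff_right)
  qed simp
  then show ?thesis by blast
qed simp

section \<open>Nodal basis of a conforming mesh\<close>

lemma triangulation_simplexD: "triangulation \<T> \<Longrightarrow> T \<in> \<T> \<Longrightarrow> \<exists>n. n simplex T"
  unfolding triangulation_def by blast

lemma triangulation_compact: "triangulation \<T> \<Longrightarrow> T \<in> \<T> \<Longrightarrow> compact T"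
  by (meson compact_simplex triangulation_simplexD)

lemma triangulation_convex: "triangulation \<T> \<Longrightarrow> T \<in> \<T> \<Longrightarrow> convex T"
  by (meson convex_simplex triangulation_simplexD)

lemma finite_nodes:
  fixes \<T> :: "(real^'n::finite) set set"
  assumes "triangulation \<T>"
  shows "finite (nodes \<T>)"
proof -
  have "finite {x. x extreme_point_of T}" if T: "T \<in> \<T>" for T
  proof -
    obtain n where "n simplex T" using triangulation_simplexD[OF assms T] by blast
    then obtain C where "finite C" "T = convex hull C"
      unfolding simplex by blast
    then show ?thesis
      using extreme_points_of_convex_hull finite_subset by metis
  qed
  moreover have "nodes \<T> = (\<Union>T\<in>\<T>. {x. x extreme_point_of T})"
    unfolding nodes_def by blast
  ultimately show ?thesis
    using assms unfolding triangulation_def by auto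
qed

lemma S_space_affine_on: "v \<in> S_space \<T> \<Longrightarrow> T \<in> \<T> \<Longrightarrow> affine_fun_on T v"
  unfolding S_space_def affine_fun_on_def by blast

lemma nodal_values_determine:
  fixes \<T> :: "(real^'n::finite) set set"
  assumes "triangulation \<T>"
    and "\<And>T. T \<in> \<T> \<Longrightarrow> affine_fun_on T u" "\<And>T. T \<in> \<T> \<Longrightarrow> affine_fun_on T v"
    and "\<And>z. z \<in> nodes \<T> \<Longrightarrow> u z = v z" and "x \<in> \<Union>\<T>"
  shows "u x = v x"
proof -
  obtain T where T: "T \<in> \<T>" "x \<in> T" using assms(5) by blast
  show ?thesis
  proof (rule affine_fun_on_eqI[of T])
    show "u z = v z" if "z extreme_point_of T" for z
      using assms(4) T(1) that unfolding nodes_def by blast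
  qed (use assms T triangulation_compact triangulation_convex in auto)
qed

text \<open>
  Conformity is what makes the simplexwise interpolants fit together: two simplices meet in a face
  of both, whose vertices are vertices of both, and on that face the two interpolants are affine with
  the same vertex values.
\<close>

lemma nodal_interpolant_exists:
  fixes \<T> :: "(real^'n::finite) set set"
  assumes tri: "triangulation \<T>"
  shows "\<exists>v\<in>S_space \<T>. (\<forall>z\<in>nodes \<T>. v z = val z) \<and> (\<forall>x. x \<notin> \<Union>\<T> \<longrightarrow> v x = 0)"
proof -
  have fin: "finite \<T>" and face: "\<And>T T'. T \<in> \<T> \<Longrightarrow> T' \<in> \<T> \<Longrightarrow> (T \<inter> T') face_of T"
    using tri unfolding triangulation_def by auto
  have "\<exists>a b. \<forall>z. z extreme_point_of T \<longrightarrow> val z = a \<bullet> z + b" if T: "T \<in> \<T>" for T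
  proof -
    obtain n where "n simplex T" using triangulation_simplexD[OF tri T] by blast
    then obtain C where "\<not> affine_dependent C" "T = convex hull C"
      unfolding simplex by blast
    then show ?thesis
      using affine_interpolation_exists[of C val] extreme_point_of_convex_hull by blast
  qed
  then obtain a b where ab: "\<And>T z. T \<in> \<T> \<Longrightarrow> z extreme_point_of T \<Longrightarrow> val z = a T \<bullet> z + b T"
    by metis
  have agree: "a T \<bullet> x + b T = a T' \<bullet> x + b T'" if "T \<in> \<T>" "T' \<in> \<T>" "x \<in> T" "x \<in> T'" for T T' x
  proof (rule affine_fun_on_eqI[of "T \<inter> T'"])
    show "compact (T \<inter> T')" "convex (T \<inter> T')"
      using that tri by (auto intro: triangulation_compact triangulation_convex convex_Int compact_Int)
    show "a T \<bullet> z + b T = a T' \<bullet> z + b T'" if "z extreme_point_of (T \<inter> T')" for z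
    proof -
      have "z extreme_point_of T" "z extreme_point_of T'"
        using that face[OF \<open>T \<in> \<T>\<close> \<open>T' \<in> \<T>\<close>] face[OF \<open>T' \<in> \<T>\<close> \<open>T \<in> \<T>\<close>]
          extreme_point_of_face[of "T \<inter> T'"] by (metis Int_commute)+
      then show ?thesis using ab \<open>T \<in> \<T>\<close> \<open>T' \<in> \<T>\<close> by metis
    qed
  qed (use that in \<open>auto simp: affine_fun_on_def\<close>)
  define v where "v x = (if x \<in> \<Union>\<T> then let T = SOME T. T \<in> \<T> \<and> x \<in> T in a T \<bullet> x + b T else 0)" for x
  have v: "v x = a T \<bullet> x + b T" if "T \<in> \<T>" "x \<in> T" for T x
  proof -
    define S where "S = (SOME T. T \<in> \<T> \<and> x \<in> T)"
    have "T \<in> \<T> \<and> x \<in> T" using that by simp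
    then have "S \<in> \<T> \<and> x \<in> S" unfolding S_def by (rule someI)
    then have "a S \<bullet> x + b S = a T \<bullet> x + b T"
      using that by (intro agree) auto
    moreover have "v x = a S \<bullet> x + b S"
      unfolding v_def Let_def S_def by (rule if_P) (use that in blast)
    ultimately show ?thesis by simp
  qed
  have "continuous_on (\<Union>T\<in>\<T>. T) v"
  proof (rule continuous_on_closed_Union[OF fin])
    fix T assume T: "T \<in> \<T>"
    show "closed T" using tri T by (simp add: compact_imp_closed triangulation_compact)
    have "continuous_on T (\<lambda>x. a T \<bullet> x + b T)" by (intro continuous_intros)
    then show "continuous_on T v"
      using v[OF T] by (simp cong: continuous_on_cong)
  qed
  then have "v \<in> S_space \<T>"
    unfolding S_space_def using v by auto
  moreover have "v z = val z" if "z \<in> nodes \<T>" for z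
    using that ab v unfolding nodes_def extreme_point_of_def by force
  moreover have "v x = 0" if "x \<notin> \<Union>\<T>" for x
    using that unfolding v_def by simp
  ultimately show ?thesis by blast
qed

lemma hat_characterization:
  fixes \<T> :: "(real^'n::finite) set set"
  assumes tri: "triangulation \<T>"
  shows "hat \<T> z \<in> S_space \<T> \<and> (\<forall>w\<in>nodes \<T>. hat \<T> z w = (if w = z then 1 else 0)) \<and>
         (\<forall>x. x \<notin> \<Union>\<T> \<longrightarrow> hat \<T> z x = 0)"
proof -
  let ?P = "\<lambda>\<phi>. \<phi> \<in> S_space \<T> \<and> (\<forall>w\<in>nodes \<T>. \<phi> w = (if w = z then 1 else 0)) \<and>
                (\<forall>x. x \<notin> \<Union>\<T> \<longrightarrow> \<phi> x = 0)"
  obtain \<phi> where \<phi>: "?P \<phi>"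
    using nodal_interpolant_exists[OF tri, of "\<lambda>w. if w = z then 1 else 0"] by blast
  have "\<exists>!\<phi>. ?P \<phi>"
  proof (intro ex1I[of ?P \<phi>])
    show "?P \<phi>" by (rule \<phi>)
  next
    fix \<psi> assume \<psi>: "?P \<psi>"
    show "\<psi> = \<phi>"
    proof (rule ext)
      fix x
      show "\<psi> x = \<phi> x"
      proof (cases "x \<in> \<Union>\<T>")
        case True
        then show ?thesis
          by (rule nodal_values_determine[OF tri, rotated -1])
             (use \<phi> \<psi> S_space_affine_on in auto)
      next
        case False
        then show ?thesis using \<phi> \<psi> by auto
      qed
    qed
  qed
  from theI'[OF this] show ?thesis
    unfolding hat_def .
qed

lemmas hat_in_S_space = hat_characterization[THEN conjunct1]

lemma hat_at_node:
  "triangulation \<T> \<Longrightarrow> w \<in> nodes \<T> \<Longrightarrow> hat \<T> z w = (if w = z then 1 else 0)"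
  using hat_characterization by blast

lemma hat_affine_on: "triangulation \<T> \<Longrightarrow> T \<in> \<T> \<Longrightarrow> affine_fun_on T (hat \<T> z)"
  using hat_in_S_space S_space_affine_on by blast

lemma interp_at_node:
  assumes "triangulation \<T>" "z \<in> nodes \<T>"
  shows "interp \<T> v z = v z"
proof -
  have "interp \<T> v z = (\<Sum>w\<in>nodes \<T>. if z = w then v w else 0)"
    unfolding interp_def using assms by (intro sum.cong) (auto simp: hat_at_node)
  then show ?thesis using assms finite_nodes[OF assms(1)] by simp
qed

lemma interp_reproduces_affine:
  fixes \<T> :: "(real^'n::finite) set set"
  assumes tri: "triangulation \<T>" and "\<And>T. T \<in> \<T> \<Longrightarrow> affine_fun_on T v" and "x \<in> \<Union>\<T>"
  shows "interp \<T> v x = v x"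
proof (rule nodal_values_determine[OF tri _ assms(2) _ assms(3)])
  show "affine_fun_on T (interp \<T> v)" if "T \<in> \<T>" for T
    using affine_fun_on_sum[of "nodes \<T>" T "hat \<T>" v] hat_affine_on[OF tri that]
    unfolding interp_def by simp
qed (use tri interp_at_node in auto)

section \<open>Dirichlet form in nodal coordinates\<close>

lemma affine_fun_on_has_derivative:
  assumes "affine_fun_on T f"
  shows "\<exists>a. \<forall>x\<in>interior T. (f has_derivative (\<lambda>h. a \<bullet> h)) (at x)"
proof -
  obtain a b where ab: "\<And>x. x \<in> T \<Longrightarrow> f x = a \<bullet> x + b"
    using assms unfolding affine_fun_on_def by blast
  have "(f has_derivative (\<lambda>h. a \<bullet> h)) (at x)" if "x \<in> interior T" for x
  proof (rule has_derivative_transform_within_open[of "\<lambda>x. a \<bullet> x + b" _ _ _ "interior T"])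
    show "((\<lambda>x. a \<bullet> x + b) has_derivative (\<lambda>h. a \<bullet> h)) (at x)"
      by (auto intro!: derivative_eq_intros)
  qed (use that ab interior_subset[of T] in auto)
  then show ?thesis by blast
qed

lemma hat_partial_deriv_constant:
  fixes \<T> :: "(real^'n::finite) set set"
  assumes "triangulation \<T>" "T \<in> \<T>"
  shows "\<exists>c. \<forall>x\<in>interior T. partial_deriv k (hat \<T> z) x = c"
proof -
  obtain a where "\<And>x. x \<in> interior T \<Longrightarrow> (hat \<T> z has_derivative (\<lambda>h. a \<bullet> h)) (at x)"
    using affine_fun_on_has_derivative[OF hat_affine_on[OF assms]] by metis
  then have "partial_deriv k (hat \<T> z) x = a \<bullet> axis k 1" if "x \<in> interior T" for x
    using that frechet_derivative_at unfolding partial_deriv_def by metis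
  then show ?thesis by blast
qed

lemma partial_deriv_interp:
  fixes \<T> :: "(real^'n::finite) set set" and v :: "real^'n \<Rightarrow> 'b::euclidean_space"
  assumes tri: "triangulation \<T>" and T: "T \<in> \<T>" "x \<in> interior T"
    and v: "\<And>y. y \<in> \<Union>\<T> \<Longrightarrow> v y = interp \<T> a y"
  shows "partial_deriv k v x = (\<Sum>z\<in>nodes \<T>. partial_deriv k (hat \<T> z) x *\<^sub>R a z)"
proof -
  define D where "D z = frechet_derivative (hat \<T> z) (at x)" for z
  have D: "(hat \<T> z has_derivative D z) (at x)" for z
    using affine_fun_on_has_derivative[OF hat_affine_on[OF tri T(1)]] T(2)
    unfolding D_def by (meson differentiable_def frechet_derivative_works)
  have "(interp \<T> a has_derivative (\<lambda>h. \<Sum>z\<in>nodes \<T>. D z h *\<^sub>R a z)) (at x)"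
    unfolding interp_def[abs_def] by (intro has_derivative_sum has_derivative_scaleR_left D)
  then have "(v has_derivative (\<lambda>h. \<Sum>z\<in>nodes \<T>. D z h *\<^sub>R a z)) (at x)"
    by (rule has_derivative_transform_within_open[of _ _ _ _ "interior T"])
       (use T v[symmetric] interior_subset[of T] in auto)
  then show ?thesis
    unfolding partial_deriv_def D_def by (simp add: frechet_derivative_at[symmetric])
qed

lemma negligible_mesh_skeleton:
  fixes \<T> :: "(real^'n::finite) set set"
  assumes "triangulation \<T>"
  shows "negligible (\<Union>T\<in>\<T>. frontier T)"
proof (rule negligible_Union)
  show "finite (frontier ` \<T>)" using assms unfolding triangulation_def by simp
qed (use assms negligible_convex_frontier triangulation_convex in blast)

lemma interior_of_simplex:
  assumes "triangulation \<T>" "x \<in> \<Union>\<T> - (\<Union>T\<in>\<T>. frontier T)"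
  shows "\<exists>T\<in>\<T>. x \<in> interior T"
proof -
  obtain T where T: "T \<in> \<T>" "x \<in> T" using assms by blast
  then have "x \<in> interior T"
    using assms(2) closure_subset[of T] unfolding frontier_def by blast
  then show ?thesis using T(1) by blast
qed

lemma interiors_disjoint:
  assumes "triangulation \<T>" "T \<in> \<T>" "T' \<in> \<T>" "x \<in> interior T" "x \<in> interior T'"
  shows "T = T'"
proof -
  have f: "(T \<inter> T') face_of T" "(T \<inter> T') face_of T'"
    using assms unfolding triangulation_def by (metis Int_commute)+
  have x: "x \<in> T \<inter> T'" using assms interior_subset by blast
  have "T \<inter> T' = T" using face_of_disjoint_interior[OF f(1)] x assms by blast
  moreover have "T \<inter> T' = T'" using face_of_disjoint_interior[OF f(2)] x assms by blast
  ultimately show ?thesis by simp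
qed

text \<open>
  Nothing is known about \<open>f\<close> on the faces of the simplices, where the partial derivatives of hat
  functions need not exist; this set is negligible.
\<close>

lemma piecewise_constant_integrable:
  fixes \<T> :: "(real^'n::finite) set set" and f :: "real^'n \<Rightarrow> real"
  assumes tri: "triangulation \<T>" and \<Omega>: "open \<Omega>" "\<Omega> \<subseteq> \<Union>\<T>" "bounded \<Omega>"
    and const: "\<And>T. T \<in> \<T> \<Longrightarrow> \<exists>c. \<forall>x\<in>interior T. f x = c"
  shows "f absolutely_integrable_on \<Omega>"
proof -
  have fin: "finite \<T>" using tri unfolding triangulation_def by simp
  obtain c where c: "\<And>T x. T \<in> \<T> \<Longrightarrow> x \<in> interior T \<Longrightarrow> f x = c T"
    using const by metis
  let ?g = "\<lambda>x. \<Sum>T\<in>\<T>. indicator (interior T) x * c T"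
  have "(\<lambda>x. indicator (interior T) x * c T) absolutely_integrable_on \<Omega>" for T
  proof -
    have "\<Omega> \<inter> interior T \<in> lmeasurable"
      using \<Omega> by (intro lmeasurable_open bounded_Int open_Int) auto
    then have "integrable lebesgue (\<lambda>x. indicator (\<Omega> \<inter> interior T) x * c T)"
      by (intro integrable_mult_left integrable_real_indicator) (auto simp: fmeasurable_def)
    then show ?thesis
      unfolding set_integrable_def by (simp add: indicator_inter_arith mult.assoc)
  qed
  then have "?g absolutely_integrable_on \<Omega>"
    by (intro absolutely_integrable_sum fin)
  then show ?thesis
  proof (rule absolutely_integrable_spike[OF _ negligible_mesh_skeleton[OF tri]])
    fix x assume x: "x \<in> \<Omega> - (\<Union>T\<in>\<T>. frontier T)"
    then obtain T where T: "T \<in> \<T>" "x \<in> interior T"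
      using interior_of_simplex[OF tri, of x] \<Omega>(2) by blast
    have "?g x = (\<Sum>S\<in>\<T>. if T = S then c S else 0)"
      using T interiors_disjoint[OF tri T(1)] by (intro sum.cong) (auto simp: indicator_def)
    then show "f x = ?g x" using T c fin by simp
  qed
qed

text \<open>
  Off the mesh skeleton the partial derivatives are linear in the nodal values.  Splitting the
  integral of the resulting double sum needs each \<open>\<nabla>\<phi>\<^sub>z \<bullet> \<nabla>\<phi>\<^sub>w\<close> to be integrable, which holds since it is
  constant on the interior of each simplex.
\<close>

lemma dirichlet_interp:
  fixes \<T> :: "(real^'n::finite) set set" and u v :: "real^'n \<Rightarrow> 'b::euclidean_space"
  assumes tri: "triangulation \<T>" and \<Omega>: "open \<Omega>" "\<Omega> \<subseteq> \<Union>\<T>" "bounded \<Omega>"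
    and u: "\<And>y. y \<in> \<Union>\<T> \<Longrightarrow> u y = interp \<T> a y"
    and v: "\<And>y. y \<in> \<Union>\<T> \<Longrightarrow> v y = interp \<T> b y"
  shows "dirichlet \<Omega> u v = - (\<Sum>z\<in>nodes \<T>. \<Sum>w\<in>nodes \<T>. stiffness \<Omega> \<T> z w * (a z \<bullet> b w))"
proof -
  note fin = finite_nodes[OF tri]
  define G where
    "G z w x = (\<Sum>k\<in>UNIV. partial_deriv k (hat \<T> z) x * partial_deriv k (hat \<T> w) x)" for z w x
  define F where "F x = (\<Sum>z\<in>nodes \<T>. \<Sum>w\<in>nodes \<T>. G z w x * (a z \<bullet> b w))" for x
  have G_int: "G z w absolutely_integrable_on \<Omega>" for z w
  proof (rule piecewise_constant_integrable[OF tri \<Omega>])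
    fix T assume T: "T \<in> \<T>"
    obtain c where "\<And>k z x. x \<in> interior T \<Longrightarrow> partial_deriv k (hat \<T> z) x = c k z"
      using hat_partial_deriv_constant[OF tri T] by metis
    then show "\<exists>e. \<forall>x\<in>interior T. G z w x = e"
      unfolding G_def by (intro exI[of _ "\<Sum>k\<in>UNIV. c k z * c k w"]) simp
  qed
  have G_dir: "integral \<Omega> (G z w) = - stiffness \<Omega> \<T> z w" for z w
    using set_lebesgue_integral_eq_integral(2)[OF G_int[of z w]]
    unfolding stiffness_def dirichlet_def G_def inner_real_def by simp
  have F_int: "F absolutely_integrable_on \<Omega>"
    unfolding F_def[abs_def]
    by (intro absolutely_integrable_sum fin set_integrable_mult_left G_int) 
  have "(F has_integral (\<Sum>z\<in>nodes \<T>. \<Sum>w\<in>nodes \<T>. - stiffness \<Omega> \<T> z w * (a z \<bullet> b w))) \<Omega>"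
    unfolding F_def[abs_def] G_dir[symmetric]
    by (intro has_integral_sum fin has_integral_mult_left integrable_integral
        set_lebesgue_integral_eq_integral(1) G_int)
  then have F_val: "integral \<Omega> F = - (\<Sum>z\<in>nodes \<T>. \<Sum>w\<in>nodes \<T>. stiffness \<Omega> \<T> z w * (a z \<bullet> b w))"
    by (simp add: integral_unique sum_negf)
  let ?f = "\<lambda>x. \<Sum>k\<in>UNIV. partial_deriv k u x \<bullet> partial_deriv k v x"
  have eq: "?f x = F x" if x: "x \<in> \<Omega> - (\<Union>T\<in>\<T>. frontier T)" for x
  proof -
    obtain T where T: "T \<in> \<T>" "x \<in> interior T"
      using interior_of_simplex[OF tri, of x] x \<Omega>(2) by blast
    have "partial_deriv k u x \<bullet> partial_deriv k v x = (\<Sum>z\<in>nodes \<T>. \<Sum>w\<in>nodes \<T>.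
        partial_deriv k (hat \<T> z) x * partial_deriv k (hat \<T> w) x * (a z \<bullet> b w))" for k
    proof -
      have "partial_deriv k u x = (\<Sum>z\<in>nodes \<T>. partial_deriv k (hat \<T> z) x *\<^sub>R a z)"
        by (rule partial_deriv_interp[OF tri T u])
      moreover have "partial_deriv k v x = (\<Sum>w\<in>nodes \<T>. partial_deriv k (hat \<T> w) x *\<^sub>R b w)"
        by (rule partial_deriv_interp[OF tri T v])
      ultimately show ?thesis
        by (simp only: inner_sum_left)
           (simp add: inner_sum_right sum_distrib_left mult.left_commute mult.assoc)
    qed
    then have "?f x = (\<Sum>k\<in>UNIV. \<Sum>z\<in>nodes \<T>. \<Sum>w\<in>nodes \<T>.
        partial_deriv k (hat \<T> z) x * partial_deriv k (hat \<T> w) x * (a z \<bullet> b w))"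
      by (simp only:)
    also have "\<dots> = (\<Sum>z\<in>nodes \<T>. \<Sum>k\<in>UNIV. \<Sum>w\<in>nodes \<T>.
        partial_deriv k (hat \<T> z) x * partial_deriv k (hat \<T> w) x * (a z \<bullet> b w))"
      by (rule sum.swap)
    also have "\<dots> = (\<Sum>z\<in>nodes \<T>. \<Sum>w\<in>nodes \<T>. \<Sum>k\<in>UNIV.
        partial_deriv k (hat \<T> z) x * partial_deriv k (hat \<T> w) x * (a z \<bullet> b w))"
      by (intro sum.cong refl sum.swap)
    finally show ?thesis
      unfolding F_def G_def by (simp add: sum_distrib_right)
  qed
  have "?f absolutely_integrable_on \<Omega>"
    by (rule absolutely_integrable_spike[OF F_int negligible_mesh_skeleton[OF tri] eq])
  then have "dirichlet \<Omega> u v = integral \<Omega> ?f"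
    unfolding dirichlet_def by (rule set_lebesgue_integral_eq_integral(2))
  also have "\<dots> = integral \<Omega> F"
    by (rule integral_spike[OF negligible_mesh_skeleton[OF tri]]) (use eq in simp)
  finally show ?thesis using F_val by simp
qed

lemma stiffness_sym: "stiffness \<Omega> \<T> z w = stiffness \<Omega> \<T> w z"
  unfolding stiffness_def dirichlet_def by (simp add: mult.commute)

text \<open>
  The hat functions sum to 1, so pairing a hat function with all of them is pairing it with a
  constant, whose gradient vanishes.
\<close>

lemma stiffness_row_sum:
  fixes \<T> :: "(real^'n::finite) set set"
  assumes tri: "triangulation \<T>" and \<Omega>: "open \<Omega>" "\<Omega> \<subseteq> \<Union>\<T>" "bounded \<Omega>"
    and z: "z \<in> nodes \<T>"
  shows "(\<Sum>w\<in>nodes \<T>. stiffness \<Omega> \<T> z w) = 0"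
proof -
  \<comment> \<open>the nodal values of the constant 1 and of \<open>hat \<T> z\<close>\<close>
  let ?one = "\<lambda>x::real^'n. 1 :: real" and ?e = "\<lambda>w. if w = z then 1 else (0::real)"
  have "dirichlet \<Omega> (hat \<T> z) ?one =
      - (\<Sum>y\<in>nodes \<T>. \<Sum>w\<in>nodes \<T>. stiffness \<Omega> \<T> y w * (?e y \<bullet> ?one w))"
  proof (rule dirichlet_interp[OF tri \<Omega>])
    fix x assume x: "x \<in> \<Union>\<T>"
    have "interp \<T> ?e x = (\<Sum>w\<in>nodes \<T>. if z = w then hat \<T> w x else 0)"
      unfolding interp_def by (intro sum.cong) auto
    then show "hat \<T> z x = interp \<T> ?e x"
      using z finite_nodes[OF tri] by simp
    show "1 = interp \<T> ?one x"
      using interp_reproduces_affine[OF tri _ x, of ?one]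
      by (force simp: affine_fun_on_def intro: exI[of _ 0])
  qed
  also have "\<dots> = - (\<Sum>y\<in>nodes \<T>. if z = y then \<Sum>w\<in>nodes \<T>. stiffness \<Omega> \<T> y w else 0)"
    by (intro arg_cong[where f = uminus] sum.cong) auto
  also have "\<dots> = - (\<Sum>w\<in>nodes \<T>. stiffness \<Omega> \<T> z w)"
    using z finite_nodes[OF tri] by simp
  finally have "dirichlet \<Omega> (hat \<T> z) ?one = - (\<Sum>w\<in>nodes \<T>. stiffness \<Omega> \<T> z w)" .
  moreover have "dirichlet \<Omega> (hat \<T> z) ?one = 0"
    unfolding dirichlet_def partial_deriv_def by (simp add: frechet_derivative_const)
  ultimately show ?thesis by simp
qed

text \<open>
  Expanding the square, the terms \<open>\<bar>a z\<bar>\<^sup>2\<close> and \<open>\<bar>a w\<bar>\<^sup>2\<close> drop out because the rows and, by symmetry, the columns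
  of the stiffness matrix sum to zero.
\<close>

lemma dirichlet_energy_differences:
  fixes \<T> :: "(real^'n::finite) set set" and v :: "real^'n \<Rightarrow> 'b::euclidean_space"
  assumes tri: "triangulation \<T>" and \<Omega>: "open \<Omega>" "\<Omega> \<subseteq> \<Union>\<T>" "bounded \<Omega>"
    and v: "\<And>y. y \<in> \<Union>\<T> \<Longrightarrow> v y = interp \<T> a y"
  shows "dirichlet \<Omega> v v =
    1 / 2 * (\<Sum>z\<in>nodes \<T>. \<Sum>w\<in>nodes \<T>. stiffness \<Omega> \<T> z w * (norm (a z - a w))\<^sup>2)"
proof -
  let ?N = "nodes \<T>" and ?k = "stiffness \<Omega> \<T>"
  have 1: "(\<Sum>z\<in>?N. \<Sum>w\<in>?N. ?k z w * (norm (a z))\<^sup>2) = 0"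
    using stiffness_row_sum[OF tri \<Omega>] by (simp flip: sum_distrib_right)
  have 2: "(\<Sum>z\<in>?N. \<Sum>w\<in>?N. ?k z w * (norm (a w))\<^sup>2) = 0"
    by (subst sum.swap) (subst stiffness_sym, rule 1)
  have "?k z w * (norm (a z - a w))\<^sup>2 =
      ?k z w * (norm (a z))\<^sup>2 + ?k z w * (norm (a w))\<^sup>2 - 2 * (?k z w * (a z \<bullet> a w))" for z w
    by (simp add: power2_norm_eq_inner inner_diff_left inner_diff_right inner_commute algebra_simps)
  then have "(\<Sum>z\<in>?N. \<Sum>w\<in>?N. ?k z w * (norm (a z - a w))\<^sup>2) =
      - 2 * (\<Sum>z\<in>?N. \<Sum>w\<in>?N. ?k z w * (a z \<bullet> a w))"
    using 1 2 by (simp add: sum.distrib sum_subtractf flip: sum_distrib_left)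
  then show ?thesis
    using dirichlet_interp[OF tri \<Omega> v v] by simp
qed

section \<open>Line fields and the energy identity\<close>

text \<open>The Frobenius norm of \<open>n \<otimes> n\<close> is \<open>\<bar>n\<bar>\<^sup>2\<close>.\<close>

lemma line_field_norm:
  assumes "L \<in> line_field_space"
  shows "norm L = 1"
proof -
  obtain n where n: "L = outer_product n n" "norm n = 1"
    using assms unfolding line_field_space_def by blast
  have "L \<bullet> L = (\<Sum>i\<in>UNIV. \<Sum>j\<in>UNIV. (n $ i * n $ i) * (n $ j * n $ j))"
    unfolding n(1) outer_product_def inner_vec_def by (simp add: algebra_simps)
  also have "\<dots> = (n \<bullet> n) * (n \<bullet> n)"
    by (simp add: inner_vec_def sum_product)
  also have "\<dots> = 1" using n(2) by (simp add: norm_eq_1)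
  finally show ?thesis by (simp add: norm_eq_1)
qed

lemma norm_diff_scaled_unit:
  fixes A B :: "'b::real_inner"
  assumes "norm A = 1" "norm B = 1"
  shows "(norm (p *\<^sub>R A - q *\<^sub>R B))\<^sup>2 = (p - q)\<^sup>2 + p * q * (norm (A - B))\<^sup>2"
proof -
  have "A \<bullet> A = 1" "B \<bullet> B = 1" using assms by (simp_all add: norm_eq_1)
  then show ?thesis
    unfolding power2_norm_eq_inner
    by (simp add: inner_diff_left inner_diff_right inner_commute power2_eq_square algebra_simps)
qed

text \<open>
  The discrete energy and the residual see only nodal values, so these are a separate argument \<open>p\<close>:
  besides \<open>p = s\<close> this covers \<open>p = \<bar>s\<bar>\<close>, which in general is not piecewise affine on the mesh.
\<close>

lemma energy_identity:
  fixes \<T> :: "(real^'n::finite) set set" and \<Theta> V :: "real^'n \<Rightarrow> real^'n^'n"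
  assumes tri: "triangulation \<T>" and \<Omega>: "open \<Omega>" "\<Omega> \<subseteq> \<Union>\<T>" "bounded \<Omega>"
    and s: "\<And>x. x \<in> \<Union>\<T> \<Longrightarrow> s x = interp \<T> p x"
    and V: "\<And>x. x \<in> \<Union>\<T> \<Longrightarrow> V x = interp \<T> (\<lambda>x. p x *\<^sub>R \<Theta> x) x"
    and \<Theta>: "\<And>z. z \<in> nodes \<T> \<Longrightarrow> norm (\<Theta> z) = 1"
  shows "E_uni_m \<Omega> \<T> p \<Theta> - E_tilde_uni_m \<Omega> s V = residual \<Omega> \<T> p \<Theta>"
proof -
  let ?k = "stiffness \<Omega> \<T>"
  let ?S = "\<lambda>f. \<Sum>z\<in>nodes \<T>. \<Sum>w\<in>nodes \<T>. (?k z w * f z w :: real)"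
  define X where "X = ?S (\<lambda>z w. (p z - p w)\<^sup>2)"
  define Y where "Y = ?S (\<lambda>z w. p z * p w * (norm (\<Theta> z - \<Theta> w))\<^sup>2)"
  define Z where "Z = ?S (\<lambda>z w. (p z - p w)\<^sup>2 * (norm (\<Theta> z - \<Theta> w))\<^sup>2)"
  have s_en: "dirichlet \<Omega> s s = 1 / 2 * X"
    using dirichlet_energy_differences[OF tri \<Omega> s] unfolding X_def by simp
  have "?S (\<lambda>z w. (norm (p z *\<^sub>R \<Theta> z - p w *\<^sub>R \<Theta> w))\<^sup>2) = X + Y"
    unfolding X_def Y_def sum.distrib[symmetric]
    by (intro sum.cong refl) (simp add: norm_diff_scaled_unit \<Theta> algebra_simps)
  then have V_en: "dirichlet \<Omega> V V = 1 / 2 * (X + Y)"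
    using dirichlet_energy_differences[OF tri \<Omega> V] by simp
  \<comment> \<open>the arithmetic mean of the squares exceeds the product by \<open>(p z - p w)\<^sup>2 / 2\<close>\<close>
  have "?k z w * (((p z)\<^sup>2 + (p w)\<^sup>2) / 2) * t =
      ?k z w * (p z * p w * t) + 1 / 2 * (?k z w * ((p z - p w)\<^sup>2 * t))" for z w t
    by (simp add: power2_eq_square field_simps)
  then have "(\<Sum>z\<in>nodes \<T>. \<Sum>w\<in>nodes \<T>.
      ?k z w * (((p z)\<^sup>2 + (p w)\<^sup>2) / 2) * (norm (\<Theta> z - \<Theta> w))\<^sup>2) = Y + 1 / 2 * Z"
    unfolding Y_def Z_def by (simp only: sum.distrib sum_distrib_left)
  then have "E_uni_m \<Omega> \<T> p \<Theta> =
      (real CARD('n) - 1) / (4 * real CARD('n)) * X + 1 / 4 * (Y + 1 / 2 * Z)"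
    unfolding E_uni_m_def X_def by simp
  moreover have "residual \<Omega> \<T> p \<Theta> = 1 / 8 * Z"
    unfolding residual_def Z_def by (simp add: mult.assoc)
  moreover have "(real CARD('n) - 1) / (4 * real CARD('n)) * X =
      1 / 4 * X - 1 / (2 * real CARD('n)) * (1 / 2 * X)"
    by (simp add: field_simps)
  ultimately show ?thesis
    unfolding E_tilde_uni_m_def s_en V_en by (simp add: add_divide_distrib)
qed

text \<open>
  Weak acuteness controls only the off-diagonal entries; the diagonal ones are multiplied by 0.
\<close>

lemma residual_nonneg:
  assumes "weakly_acute \<Omega> \<T>"
  shows "residual \<Omega> \<T> s \<Theta> \<ge> 0"
proof -
  have "stiffness \<Omega> \<T> z w * (s z - s w)\<^sup>2 * (norm (\<Theta> z - \<Theta> w))\<^sup>2 \<ge> 0"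
    if "z \<in> nodes \<T>" "w \<in> nodes \<T>" for z w
    using assms that unfolding weakly_acute_def by (cases "z = w") auto
  then show ?thesis
    unfolding residual_def by (auto intro!: sum_nonneg)
qed

text \<open>
  Passing to \<open>\<bar>s\<bar>\<close> leaves the second sum of the energy alone and can only decrease the nodal
  differences in the first, whose coefficients are nonnegative off the diagonal.
\<close>

lemma energy_abs_le:
  fixes \<Omega> :: "(real^'n::finite) set"
  assumes acute: "weakly_acute \<Omega> \<T>"
  shows "E_uni_m \<Omega> \<T> (\<lambda>x. \<bar>s x\<bar>) \<Theta> \<le> E_uni_m \<Omega> \<T> s \<Theta>"
proof -
  have "stiffness \<Omega> \<T> z w * (\<bar>s z\<bar> - \<bar>s w\<bar>)\<^sup>2 \<le> stiffness \<Omega> \<T> z w * (s z - s w)\<^sup>2"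
    if "z \<in> nodes \<T>" "w \<in> nodes \<T>" for z w
  proof (cases "z = w")
    case False
    have "(\<bar>s z\<bar> - \<bar>s w\<bar>)\<^sup>2 \<le> (s z - s w)\<^sup>2"
      by (rule abs_le_square_iff[THEN iffD1]) (rule abs_triangle_ineq3)
    then show ?thesis
      using acute that False unfolding weakly_acute_def by (simp add: mult_left_mono)
  qed simp
  then have "(\<Sum>z\<in>nodes \<T>. \<Sum>w\<in>nodes \<T>. stiffness \<Omega> \<T> z w * (\<bar>s z\<bar> - \<bar>s w\<bar>)\<^sup>2) \<le>
      (\<Sum>z\<in>nodes \<T>. \<Sum>w\<in>nodes \<T>. stiffness \<Omega> \<T> z w * (s z - s w)\<^sup>2)"
    by (intro sum_mono)
  moreover have "(real CARD('n) - 1) / (4 * real CARD('n)) \<ge> 0"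
    using zero_less_card_finite[where 'a = 'n] by (simp add: Suc_le_eq)
  ultimately show ?thesis
    unfolding E_uni_m_def power2_abs by (intro add_right_mono mult_left_mono)
qed

theorem lemma1:
  fixes \<Omega> \<Gamma>\<^sub>s \<Gamma>\<^sub>\<Theta> :: "(real^'n::finite) set"
    and \<F> :: "(real^'n) set set set"
    and \<T> :: "(real^'n) set set"
    and g s :: "real^'n \<Rightarrow> real"
    and M R \<Theta> U :: "real^'n \<Rightarrow> real^'n^'n"
  assumes "CARD('n) \<ge> 2"
    and "bounded_polyhedral_domain \<Omega>"
    and "openin (top_of_set (frontier \<Omega>)) \<Gamma>\<^sub>s"
    and "openin (top_of_set (frontier \<Omega>)) \<Gamma>\<^sub>\<Theta>"
    and "admissible_data \<Omega> g M R"
    and "\<And>\<T>'. \<T>' \<in> \<F> \<Longrightarrow> conforming_mesh \<Omega> \<T>'"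
    and "shape_regular \<F>"
    and "quasi_uniform \<F>"
    and "\<T> \<in> \<F>"
    and "weakly_acute \<Omega> \<T>"
    and "(s, \<Theta>, U) \<in> A_uni \<T> \<Gamma>\<^sub>s \<Gamma>\<^sub>\<Theta> (interp \<T> g) (interp \<T> M) (interp \<T> R)"
  defines "s' \<equiv> interp \<T> (\<lambda>x. \<bar>s x\<bar>)"
    and "U' \<equiv> interp \<T> (\<lambda>x. \<bar>s x\<bar> *\<^sub>R \<Theta> x)"
  shows "E_uni_m \<Omega> \<T> s \<Theta> - E_tilde_uni_m \<Omega> s U = residual \<Omega> \<T> s \<Theta> \<and>
         residual \<Omega> \<T> s \<Theta> \<ge> 0 \<and>
         E_uni_m \<Omega> \<T> s \<Theta> - E_tilde_uni_m \<Omega> s' U' \<ge> residual \<Omega> \<T> s' \<Theta> \<and>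
         residual \<Omega> \<T> s' \<Theta> \<ge> 0"
proof -
  have mesh: "conforming_mesh \<Omega> \<T>" using assms(6,9) by blast
  then have tri: "triangulation \<T>" and cl: "\<Union>\<T> = closure \<Omega>"
    unfolding conforming_mesh_def by auto
  have \<Omega>: "open \<Omega>" "\<Omega> \<subseteq> \<Union>\<T>" "bounded \<Omega>"
    using assms(2) cl closure_subset unfolding bounded_polyhedral_domain_def by auto
  have adm: "s \<in> S_space \<T>" "\<Theta> \<in> T_space \<T>"
      "\<And>x. x \<in> \<Union>\<T> \<Longrightarrow> U x = interp \<T> (\<lambda>y. s y *\<^sub>R \<Theta> y) x"
    using assms(11) unfolding A_uni_def by auto
  have unit: "norm (\<Theta> z) = 1" if "z \<in> nodes \<T>" for z
    using adm(2) that line_field_norm unfolding T_space_def by blast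
  have s: "s x = interp \<T> s x" if "x \<in> \<Union>\<T>" for x
    using interp_reproduces_affine[OF tri _ that] S_space_affine_on[OF adm(1)] by simp
  have eq: "E_uni_m \<Omega> \<T> s \<Theta> - E_tilde_uni_m \<Omega> s U = residual \<Omega> \<T> s \<Theta>"
    by (rule energy_identity[OF tri \<Omega> s adm(3) unit])
  have "E_uni_m \<Omega> \<T> (\<lambda>x. \<bar>s x\<bar>) \<Theta> - E_tilde_uni_m \<Omega> s' U' = residual \<Omega> \<T> (\<lambda>x. \<bar>s x\<bar>) \<Theta>"
    by (rule energy_identity[OF tri \<Omega> _ _ unit]) (simp_all add: s'_def U'_def)
  moreover have "residual \<Omega> \<T> s' \<Theta> = residual \<Omega> \<T> (\<lambda>x. \<bar>s x\<bar>) \<Theta>"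
    unfolding residual_def s'_def by (simp add: interp_at_node[OF tri])
  ultimately have "E_uni_m \<Omega> \<T> s \<Theta> - E_tilde_uni_m \<Omega> s' U' \<ge> residual \<Omega> \<T> s' \<Theta>"
    using energy_abs_le[OF assms(10), of s \<Theta>] by linarith
  then show ?thesis
    using eq residual_nonneg[OF assms(10)] by blast
qed

end
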